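(* Let $d\ge 1$, $r\ge 1$ and $n_1,\ldots,n_d\ge 3$ be integers, and let $\emptyset\neq\mathcal{A}\subseteq\mathbb{Z}_2^{d+r}\setminus\{\mathbf{0}\}$. Suppose that the last $r$ coordinates of each element of $\mathcal{A}$ are equal to $0$. Then $\mathrm{NEPS}(K_{n_1},\ldots,K_{n_d},r\odot K_2;\mathcal{A})$ is periodic with period $\frac{2\pi}{h}$, where $h=\gcd(n_1,\ldots,n_d)$.
   Context: For a graph $G$ with adjacency matrix $A_G$, its transition matrix is $H_{A_G}(t)=\exp(-\mathrm{i}tA_G)$, $t\in\mathbb{R}$. A graph is periodic with period $\tau$ if $|H_{A_G}(\tau)_{u,u}|=1$ for every vertex $u$ (with the same $\tau$). For graphs $G_1,\ldots,G_m$ and $\emptyset\ne\mathcal{B}\subseteq\mathbb{Z}_2^m\setminus\{\mathbf{0}\}$, $\mathrm{NEPS}(G_1,\ldots,G_m;\mathcal{B})$ is the graph with vertex set $V(G_1)\times\cdots\times V(G_m)$ in which $(u_1,\ldots,u_m)$ and $(v_1,\ldots,v_m)$ are adjacent iff there is $(a_1,\ldots,a_m)\in\mathcal{B}$ such that $u_i=v_i$ whenever $a_i=0$ and $u_i$ is adjacent to $v_i$ in $G_i$ whenever $a_i=1$. $\mathrm{NEPS}(K_{n_1},\ldots,K_{n_d},r\odot K_2;\mathcal{A})$ denotes the NEPS of $K_{n_1},\ldots,K_{n_d}$ followed by $r$ copies of $K_2$, with basis $\mathcal{A}$. *)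

theory Defs
  imports Complex_Main "HOL-Library.Z2" "Graph_Theory.Graph_Theory"
begin

text \<open>
  A finite simple graph is a \<^typ>\<open>'a pair_pre_digraph\<close> satisfying \<^locale>\<open>pair_graph\<close>: finite,
  loop-free, with a symmetric set of arcs.  A matrix indexed by a finite set \<open>V\<close> is a function
  \<open>'v \<Rightarrow> 'v \<Rightarrow> complex\<close>, of which only the entries with indices in \<open>V\<close> are relevant; the product
  of \<open>M\<close> and \<open>N\<close> has the entries \<open>\<Sum>w\<in>V. M u w * N w v\<close>.
\<close>

primrec mat_power_on :: "'v set \<Rightarrow> ('v \<Rightarrow> 'v \<Rightarrow> complex) \<Rightarrow> nat \<Rightarrow> 'v \<Rightarrow> 'v \<Rightarrow> complex" where
  "mat_power_on V M 0 u v = (if u = v then 1 else 0)"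
| "mat_power_on V M (Suc k) u v = (\<Sum>w\<in>V. M u w * mat_power_on V M k w v)"

definition mat_exp_on :: "'v set \<Rightarrow> ('v \<Rightarrow> 'v \<Rightarrow> complex) \<Rightarrow> 'v \<Rightarrow> 'v \<Rightarrow> complex" where
  "mat_exp_on V M u v = (\<Sum>k. mat_power_on V M k u v / fact k)"

definition adj_matrix :: "'v pair_pre_digraph \<Rightarrow> 'v \<Rightarrow> 'v \<Rightarrow> complex" where
  "adj_matrix G u v = (if (u, v) \<in> parcs G then 1 else 0)"

definition transition_matrix :: "'v pair_pre_digraph \<Rightarrow> real \<Rightarrow> 'v \<Rightarrow> 'v \<Rightarrow> complex" where
  "transition_matrix G t =
     mat_exp_on (pverts G) (\<lambda>u v. - \<i> * complex_of_real t * adj_matrix G u v)"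

definition periodic_with_period :: "'v pair_pre_digraph \<Rightarrow> real \<Rightarrow> bool" where
  "periodic_with_period G \<tau> \<longleftrightarrow> (\<forall>u\<in>pverts G. cmod (transition_matrix G \<tau> u u) = 1)"

definition complete_graph :: "nat \<Rightarrow> nat pair_pre_digraph" where
  "complete_graph n = \<lparr>pverts = {..<n}, parcs = {(u, v). u < n \<and> v < n \<and> u \<noteq> v}\<rparr>"

text \<open>
  Vertices of the NEPS are lists \<open>[u\<^sub>1, \<dots>, u\<^sub>m]\<close>, and vectors over the two-element field are
  lists over \<^typ>\<open>bit\<close>; coordinates are counted from \<open>0\<close>.
\<close>

definition NEPS :: "'a pair_pre_digraph list \<Rightarrow> bit list set \<Rightarrow> 'a list pair_pre_digraph" where
  "NEPS Gs B =
     (let V = {u. length u = length Gs \<and> (\<forall>i<length Gs. u ! i \<in> pverts (Gs ! i))}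
      in \<lparr>pverts = V,
          parcs = {(u, v). u \<in> V \<and> v \<in> V \<and>
            (\<exists>a\<in>B. \<forall>i<length Gs. (a ! i = 0 \<longrightarrow> u ! i = v ! i) \<and>
                                 (a ! i = 1 \<longrightarrow> (u ! i, v ! i) \<in> parcs (Gs ! i)))}\<rparr>)"

definition Z2_vectors :: "nat \<Rightarrow> bit list set" where
  "Z2_vectors m = {a. length a = m}"


text \<open>The series defining the matrix exponential converges for every finite index set.\<close>

lemma norm_mat_power_on_le:
  assumes "finite V" "u \<in> V"
  shows "norm (mat_power_on V M k u v) \<le> (\<Sum>x\<in>V. \<Sum>y\<in>V. norm (M x y)) ^ k"
  using assms(2)
proof (induction k arbitrary: u)
  case 0
  then show ?case by simp
next
  case (Suc k)
  let ?C = "\<Sum>x\<in>V. \<Sum>y\<in>V. norm (M x y)"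
  have "norm (mat_power_on V M (Suc k) u v) \<le> (\<Sum>w\<in>V. norm (M u w * mat_power_on V M k w v))"
    by (simp add: norm_sum)
  also have "\<dots> \<le> (\<Sum>w\<in>V. norm (M u w) * ?C ^ k)"
    by (intro sum_mono) (simp add: norm_mult mult_left_mono Suc.IH)
  also have "\<dots> = (\<Sum>w\<in>V. norm (M u w)) * ?C ^ k"
    by (simp add: sum_distrib_right)
  also have "\<dots> \<le> ?C * ?C ^ k"
    by (intro mult_right_mono member_le_sum[where f = "\<lambda>x. \<Sum>y\<in>V. norm (M x y)"])
       (auto simp: assms(1) Suc.prems sum_nonneg)
  finally show ?case by simp
qed

lemma summable_mat_exp_on:
  assumes "finite V" "u \<in> V"
  shows "summable (\<lambda>k. mat_power_on V M k u v / fact k)"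
proof (rule summable_comparison_test)
  let ?C = "\<Sum>x\<in>V. \<Sum>y\<in>V. norm (M x y)"
  show "summable (\<lambda>k. inverse (fact k) * ?C ^ k)"
    by (rule summable_exp)
  show "\<exists>N. \<forall>k\<ge>N. norm (mat_power_on V M k u v / fact k) \<le> inverse (fact k) * ?C ^ k"
    using norm_mat_power_on_le[OF assms]
    by (auto simp: norm_divide divide_simps)
qed

lemma complete_digraph_complete_graph: "complete_digraph n (with_proj (complete_graph n))"
  unfolding complete_digraph_pair_def by (auto simp: complete_graph_def)

lemma pair_graph_NEPS:
  assumes G: "\<And>G. G \<in> set Gs \<Longrightarrow> pair_graph G"
    and B: "B \<subseteq> Z2_vectors (length Gs) - {replicate (length Gs) 0}"
  shows "pair_graph (NEPS Gs B)"
proof -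
  let ?V = "pverts (NEPS Gs B)"
  have G': "pair_graph (Gs ! i)" if "i < length Gs" for i
    using G that by simp
  have "?V \<subseteq> {u. set u \<subseteq> (\<Union>G\<in>set Gs. pverts G) \<and> length u = length Gs}"
    by (fastforce simp: NEPS_def in_set_conv_nth)
  moreover have "finite (\<Union>G\<in>set Gs. pverts G)"
    using G by (auto simp: pair_graph_def pair_digraph_def pair_fin_digraph_def
        pair_fin_digraph_axioms_def)
  ultimately have fin: "finite ?V"
    using finite_lists_length_eq finite_subset by blast
  have sub: "parcs (NEPS Gs B) \<subseteq> ?V \<times> ?V"
    by (auto simp: NEPS_def)
  have symG: "(y, x) \<in> parcs (Gs ! i)" if "i < length Gs" "(x, y) \<in> parcs (Gs ! i)" for i x y
    using pair_sym_digraph.pair_sym_arcs[of "Gs ! i"] G'[OF that(1)] that(2)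
    by (auto simp: pair_graph_def pair_pseudo_graph_def symmetric_def elim: symE)
  have loopG: "(x, x) \<notin> parcs (Gs ! i)" if "i < length Gs" for i x
    using pair_loopfree_digraph.pair_no_loops[of "Gs ! i" "(x, x)"] G'[OF that]
    by (auto simp: pair_graph_def pair_digraph_def)
  have "symmetric (with_proj (NEPS Gs B))"
    unfolding symmetric_def sym_def by (auto simp: NEPS_def) (metis symG)
  moreover have "(u, u) \<notin> parcs (NEPS Gs B)" for u
  proof
    assume "(u, u) \<in> parcs (NEPS Gs B)"
    then obtain a where a: "a \<in> B"
      "\<And>i. i < length Gs \<Longrightarrow> a ! i = 1 \<Longrightarrow> (u ! i, u ! i) \<in> parcs (Gs ! i)"
      by (auto simp: NEPS_def)
    have "a ! i = 0" if "i < length Gs" for i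
      using a(2)[OF that] loopG[OF that] by (metis bit_not_zero_iff)
    moreover have "length a = length Gs"
      using a(1) B by (auto simp: Z2_vectors_def)
    ultimately have "a = replicate (length Gs) 0"
      by (simp add: list_eq_iff_nth_eq)
    then show False
      using a(1) B by auto
  qed
  ultimately show ?thesis
    using sub fin finite_subset[OF sub] by unfold_locales auto
qed

end

theory Submission
  imports Defs "HOL-Library.FuncSet" "HOL-Number_Theory.Cong" "HOL-Analysis.Complex_Transcendental"
begin

text \<open>
  The unit vector at a vertex of \<open>K\<^sub>n\<close> is the sum of a constant vector,
  with eigenvalue \<open>n - 1\<close>, and a vector of sum zero, with eigenvalue \<open>-1\<close>.  Multiplying these
  decompositions over the coordinates writes a unit vector of the NEPS as a sum of eigenvectors
  with the integer eigenvalues \<open>\<Sum>a\<in>B. \<Prod>i | a\<^sub>i = 1. \<theta>\<^sub>i\<close>, where \<open>\<theta>\<^sub>i \<in> {n\<^sub>i - 1, -1}\<close>.  Since \<open>h\<close> divides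
  every \<open>n\<^sub>i\<close> that matters, these are all congruent modulo \<open>h\<close>, so that at time \<open>2 * pi / h\<close> the
  transition matrix is a unimodular scalar matrix.
\<close>

section \<open>Matrix exponentials from eigenvector decompositions\<close>

text \<open>The \<open>k\<close>-th power of \<open>M\<close> is applied to the unit vector at
  \<open>v\<close>, which is the sum of the eigenvectors \<open>f s\<close>; each step multiplies
  \<open>f s\<close> by \<open>\<mu> s\<close>. Only this one vector has to be decomposed.\<close>

lemma mat_power_on_eigenvectors:
  assumes "u \<in> V"
    and eig: "\<And>s x. s \<in> S \<Longrightarrow> x \<in> V \<Longrightarrow> (\<Sum>w\<in>V. M x w * f s w) = \<mu> s * f s x"
    and dec: "\<And>x. x \<in> V \<Longrightarrow> (\<Sum>s\<in>S. f s x) = (if x = v then 1 else 0)"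
  shows "mat_power_on V M k u v = (\<Sum>s\<in>S. \<mu> s ^ k * f s u)"
  using assms(1)
proof (induction k arbitrary: u)
  case 0
  then show ?case by (simp add: dec)
next
  case (Suc k)
  have "mat_power_on V M (Suc k) u v = (\<Sum>w\<in>V. \<Sum>s\<in>S. \<mu> s ^ k * (M u w * f s w))"
    by (simp add: Suc.IH sum_distrib_left mult_ac)
  also have "\<dots> = (\<Sum>s\<in>S. \<mu> s ^ k * (\<Sum>w\<in>V. M u w * f s w))"
    by (subst sum.swap) (simp add: sum_distrib_left)
  also have "\<dots> = (\<Sum>s\<in>S. \<mu> s ^ Suc k * f s u)"
    using Suc.prems by (intro sum.cong) (simp_all add: eig)
  finally show ?case .
qed

lemma mat_exp_on_eigenvectors:
  assumes "u \<in> V"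
    and "\<And>s x. s \<in> S \<Longrightarrow> x \<in> V \<Longrightarrow> (\<Sum>w\<in>V. M x w * f s w) = \<mu> s * f s x"
    and "\<And>x. x \<in> V \<Longrightarrow> (\<Sum>s\<in>S. f s x) = (if x = v then 1 else 0)"
  shows "mat_exp_on V M u v = (\<Sum>s\<in>S. exp (\<mu> s) * f s u)"
proof -
  have "(\<lambda>k. \<Sum>s\<in>S. (\<mu> s ^ k /\<^sub>R fact k) * f s u) sums (\<Sum>s\<in>S. exp (\<mu> s) * f s u)"
    by (intro sums_sum sums_mult2 exp_converges)
  moreover have "mat_power_on V M k u v / fact k = (\<Sum>s\<in>S. (\<mu> s ^ k /\<^sub>R fact k) * f s u)" for k
    by (simp add: mat_power_on_eigenvectors[OF assms] sum_divide_distrib scaleR_conv_of_real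
        field_simps)
  ultimately show ?thesis
    by (simp add: mat_exp_on_def sums_iff)
qed

section \<open>Eigenvectors of a NEPS\<close>

text \<open>Distributivity in the form \<open>prod_sum_PiE\<close>, carried over from extensional
  functions to the lists that serve as vertices.\<close>

lemma sum_prod_lists:
  fixes F :: "nat \<Rightarrow> 'a \<Rightarrow> 'b::comm_semiring_1"
  assumes "\<And>i. i < m \<Longrightarrow> finite (X i)"
  shows "(\<Sum>w | length w = m \<and> (\<forall>i<m. w ! i \<in> X i). \<Prod>i<m. F i (w ! i)) = (\<Prod>i<m. \<Sum>x\<in>X i. F i x)"
proof -
  have "(\<Prod>i<m. \<Sum>x\<in>X i. F i x) = (\<Sum>g\<in>PiE {..<m} X. \<Prod>i<m. F i (g i))"
    using assms by (intro prod_sum_PiE) auto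
  also have "\<dots> = (\<Sum>w | length w = m \<and> (\<forall>i<m. w ! i \<in> X i). \<Prod>i<m. F i (w ! i))"
    by (rule sum.reindex_bij_witness[where i = "\<lambda>w. restrict ((!) w) {..<m}"
          and j = "\<lambda>g. map g [0..<m]"])
       (auto simp: list_eq_iff_nth_eq PiE_iff extensional_def fun_eq_iff)
  finally show ?thesis by simp
qed

text \<open>This is the sum over \<open>B\<close> of Kronecker products of identity and adjacency
  matrices. The sum counts the basis vectors witnessing an adjacency, and there is at most
  one.\<close>

lemma adj_matrix_NEPS:
  assumes B: "B \<subseteq> Z2_vectors (length Gs)"
    and loop: "\<And>i x. i < length Gs \<Longrightarrow> (x, x) \<notin> parcs (Gs ! i)"
    and uv: "u \<in> pverts (NEPS Gs B)" "v \<in> pverts (NEPS Gs B)"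
  shows "adj_matrix (NEPS Gs B) u v =
    (\<Sum>a\<in>B. \<Prod>i<length Gs. if a ! i = 0 then of_bool (u ! i = v ! i)
                           else adj_matrix (Gs ! i) (u ! i) (v ! i))"
proof -
  define P where "P a \<longleftrightarrow> (\<forall>i<length Gs. (a ! i = 0 \<longrightarrow> u ! i = v ! i) \<and>
    (a ! i = 1 \<longrightarrow> (u ! i, v ! i) \<in> parcs (Gs ! i)))" for a :: "bit list"
  have len: "length a = length Gs" if "a \<in> B" for a
    using that B by (auto simp: Z2_vectors_def)
  have "(UNIV :: bit set) = {0, 1}"
    using bit_not_zero_iff by blast
  moreover have "finite {0, 1 :: bit}"
    by simp
  ultimately have "finite (UNIV :: bit set)"
    by simp
  then have fin: "finite B"
    using finite_lists_length_eq[of "UNIV :: bit set" "length Gs"] B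
    by (auto simp: Z2_vectors_def intro: finite_subset)
  have "(\<Prod>i<length Gs. if a ! i = 0 then of_bool (u ! i = v ! i)
           else adj_matrix (Gs ! i) (u ! i) (v ! i)) = of_bool (P a)" (is "prod ?F _ = _") for a
  proof (cases "P a")
    case True
    then have "?F i = 1" if "i < length Gs" for i
      using that by (cases "a ! i") (simp_all add: P_def adj_matrix_def)
    then show ?thesis
      using True by simp
  next
    case False
    then obtain i where "i < length Gs" "?F i = 0"
      by (auto simp: P_def adj_matrix_def)
    then have "prod ?F {..<length Gs} = 0"
      by (intro prod_zero) blast+
    then show ?thesis
      using False by simp
  qed
  moreover have "(\<Sum>a\<in>B. of_bool (P a)) = (of_bool (\<exists>a\<in>B. P a) :: complex)"
  proof (cases "\<exists>a\<in>B. P a")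
    case True
    then obtain a where a: "a \<in> B" "P a" by auto
    have "a' = a" if "a' \<in> B" "P a'" for a'
    proof (rule nth_equalityI)
      show "length a' = length a"
        using that a len by simp
      fix i assume "i < length a'"
      then have i: "i < length Gs"
        using that len by simp
      \<comment> \<open>If \<open>b ! i = 1\<close>, the entries of \<open>u\<close> and
        \<open>v\<close> at \<open>i\<close> are adjacent, hence distinct in the absence of loops.
        So \<open>u\<close> and \<open>v\<close> determine the witness.\<close>
      have "b ! i = 0 \<longleftrightarrow> u ! i = v ! i" if "P b" for b
        using that i loop[OF i, of "u ! i"] by (cases "b ! i") (auto simp: P_def)
      then show "a' ! i = a ! i"
        using a(2) that(2) by (metis bit_not_zero_iff)
    qed
    then have "P a' \<longleftrightarrow> a' = a" if "a' \<in> B" for a'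
      using a that by blast
    then have "(\<Sum>a'\<in>B. of_bool (P a')) = (\<Sum>a'\<in>B. if a' = a then 1 else 0 :: complex)"
      by (intro sum.cong refl) (simp add: of_bool_def)
    then show ?thesis
      using a fin True by simp
  qed simp
  moreover have "(u, v) \<in> parcs (NEPS Gs B) \<longleftrightarrow> (\<exists>a\<in>B. P a)"
    using uv by (simp add: NEPS_def P_def)
  ultimately show ?thesis
    by (simp add: adj_matrix_def)
qed

text \<open>A Kronecker product acts on a product vector coordinate by coordinate; an identity
  factor contributes the eigenvalue 1, an adjacency factor \<open>\<theta> i\<close>.\<close>

lemma NEPS_eigenvector:
  assumes B: "B \<subseteq> Z2_vectors (length Gs)"
    and loop: "\<And>i x. i < length Gs \<Longrightarrow> (x, x) \<notin> parcs (Gs ! i)"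
    and fin: "\<And>i. i < length Gs \<Longrightarrow> finite (pverts (Gs ! i))"
    and eig: "\<And>i x. i < length Gs \<Longrightarrow> x \<in> pverts (Gs ! i) \<Longrightarrow>
      (\<Sum>y\<in>pverts (Gs ! i). adj_matrix (Gs ! i) x y * g i y) = \<theta> i * g i x"
    and u: "u \<in> pverts (NEPS Gs B)"
  shows "(\<Sum>w\<in>pverts (NEPS Gs B). adj_matrix (NEPS Gs B) u w * (\<Prod>i<length Gs. g i (w ! i))) =
    (\<Sum>a\<in>B. \<Prod>i<length Gs. if a ! i = 0 then 1 else \<theta> i) * (\<Prod>i<length Gs. g i (u ! i))"
proof -
  let ?m = "length Gs"
  define F where "F a i x = (if a ! i = 0 then of_bool (u ! i = x)
    else adj_matrix (Gs ! i) (u ! i) x) * g i x" for a :: "bit list" and i x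
  have V: "pverts (NEPS Gs B) = {w. length w = ?m \<and> (\<forall>i<?m. w ! i \<in> pverts (Gs ! i))}"
    by (simp add: NEPS_def)
  have "(\<Sum>w\<in>pverts (NEPS Gs B). adj_matrix (NEPS Gs B) u w * (\<Prod>i<?m. g i (w ! i))) =
    (\<Sum>w\<in>pverts (NEPS Gs B). \<Sum>a\<in>B. \<Prod>i<?m. F a i (w ! i))"
    by (intro sum.cong refl)
       (simp add: adj_matrix_NEPS[OF B loop u] F_def prod.distrib sum_distrib_right)
  also have "\<dots> = (\<Sum>a\<in>B. \<Prod>i<?m. \<Sum>x\<in>pverts (Gs ! i). F a i x)"
    unfolding V by (subst sum.swap) (intro sum.cong refl sum_prod_lists fin)
  also have "\<dots> = (\<Sum>a\<in>B. \<Prod>i<?m. (if a ! i = 0 then 1 else \<theta> i) * g i (u ! i))"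
  proof (intro sum.cong prod.cong refl)
    fix a i assume "i \<in> {..<?m}"
    then have i: "i < ?m" "u ! i \<in> pverts (Gs ! i)"
      using u by (auto simp: V)
    have "(\<Sum>x\<in>pverts (Gs ! i). of_bool (u ! i = x) * g i x) =
      (\<Sum>x\<in>pverts (Gs ! i). if u ! i = x then g i x else 0)"
      by (intro sum.cong) auto
    also have "\<dots> = g i (u ! i)"
      using i fin by simp
    finally show "(\<Sum>x\<in>pverts (Gs ! i). F a i x) = (if a ! i = 0 then 1 else \<theta> i) * g i (u ! i)"
      using i by (simp add: F_def eig)
  qed
  also have "\<dots> = (\<Sum>a\<in>B. \<Prod>i<?m. if a ! i = 0 then 1 else \<theta> i) * (\<Prod>i<?m. g i (u ! i))"
    by (simp add: prod.distrib sum_distrib_right)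
  finally show ?thesis .
qed

section \<open>Complete graphs and periodicity\<close>

lemma adj_matrix_complete_graph_mult:
  assumes "x < n"
  shows "(\<Sum>y<n. adj_matrix (complete_graph n) x y * g y) = (\<Sum>y<n. g y) - g x"
proof -
  have "(\<Sum>y<n. adj_matrix (complete_graph n) x y * g y) =
    (\<Sum>y<n. g y - (if y = x then g y else 0))"
    using assms by (intro sum.cong) (auto simp: adj_matrix_def complete_graph_def)
  then show ?thesis
    using assms by (simp add: sum_subtractf)
qed

lemma exp_2pi_i_cong:
  fixes j k :: int
  assumes "[j = k] (mod int h)" "h > 0"
  shows "exp (- \<i> * complex_of_real (2 * pi / real h) * of_int j) =
    exp (- \<i> * complex_of_real (2 * pi / real h) * of_int k)"
proof -
  obtain l where "k = j + int h * l"
    using assms(1) by (metis cong_iff_lin)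
  \<comment> \<open>The shift by a multiple of \<open>2 * pi * \<i>\<close> is written in the form
    that \<open>exp_eq\<close> expects.\<close>
  then have "- \<i> * complex_of_real (2 * pi / real h) * of_int j =
    - \<i> * complex_of_real (2 * pi / real h) * of_int k + (of_int (2 * l) * pi) * \<i>"
    using assms(2) by (simp add: field_simps)
  then show ?thesis
    by (subst exp_eq) blast
qed

text \<open>The factors \<open>K_2\<close> get no special treatment: \<open>h\<close> must divide an
  order only at coordinates where some basis vector is nonzero, since no other
  \<open>\<theta> i\<close> enters an eigenvalue.\<close>

theorem NEPS_complete_graphs_periodic:
  fixes ms :: "nat list" and B :: "bit list set" and h :: nat
  assumes pos: "\<And>n. n \<in> set ms \<Longrightarrow> n > 0"
    and B: "B \<subseteq> Z2_vectors (length ms)"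
    and h: "h > 0"
    and dvd: "\<And>a i. a \<in> B \<Longrightarrow> i < length ms \<Longrightarrow> a ! i \<noteq> 0 \<Longrightarrow> h dvd ms ! i"
  shows "periodic_with_period (NEPS (map complete_graph ms) B) (2 * pi / real h)"
  unfolding periodic_with_period_def
proof
  let ?m = "length ms" and ?Gs = "map complete_graph ms"
  let ?N = "NEPS ?Gs B" and ?c = "- \<i> * complex_of_real (2 * pi / real h)"
  fix v assume v: "v \<in> pverts ?N"
  \<comment> \<open>\<open>s i\<close> selects, at coordinate \<open>i\<close>, the constant part or
    the sum-zero part of the unit vector at \<open>v ! i\<close>.\<close>
  define S where "S = PiE {..<?m} (\<lambda>_. UNIV :: bool set)"
  define g :: "(nat \<Rightarrow> bool) \<Rightarrow> nat \<Rightarrow> nat \<Rightarrow> complex" where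
    "g s i x = (if s i then 1 / of_nat (ms ! i) else of_bool (x = v ! i) - 1 / of_nat (ms ! i))"
    for s i x
  define \<theta> :: "(nat \<Rightarrow> bool) \<Rightarrow> nat \<Rightarrow> int" where
    "\<theta> s i = (if s i then int (ms ! i) - 1 else - 1)" for s i
  \<comment> \<open>The argument is arbitrary so that the eigenvalues
    \<open>\<Lambda> (\<theta> s)\<close> can be compared with the value at the constant -1.\<close>
  define \<Lambda> :: "(nat \<Rightarrow> int) \<Rightarrow> int" where
    "\<Lambda> t = (\<Sum>a\<in>B. \<Prod>i<?m. if a ! i = 0 then 1 else t i)" for t
  define f where "f s w = (\<Prod>i<?m. g s i (w ! i))" for s and w :: "nat list"
  have ms: "ms ! i > 0" if "i < ?m" for i
    using pos that by simp
  have vi: "v ! i < ms ! i" if "i < ?m" for i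
    using v that by (auto simp: NEPS_def complete_graph_def)
  have pverts: "pverts (complete_graph n) = {..<n}" for n
    by (simp add: complete_graph_def)
  have eig: "(\<Sum>w\<in>pverts ?N. ?c * adj_matrix ?N u w * f s w) = ?c * of_int (\<Lambda> (\<theta> s)) * f s u"
    if "u \<in> pverts ?N" for s u
  proof -
    have "(\<Sum>w\<in>pverts ?N. adj_matrix ?N u w * (\<Prod>i<length ?Gs. g s i (w ! i))) =
      (\<Sum>a\<in>B. \<Prod>i<length ?Gs. if a ! i = 0 then 1 else of_int (\<theta> s i)) *
      (\<Prod>i<length ?Gs. g s i (u ! i))"
    proof (rule NEPS_eigenvector)
      fix i x assume i: "i < length ?Gs" and "x \<in> pverts (?Gs ! i)"
      then have x: "x < ms ! i" by (simp add: complete_graph_def)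
      have "(\<Sum>y<ms ! i. g s i y) = of_bool (s i)"
        using i ms[of i] vi[of i] by (simp add: g_def sum_subtractf of_bool_def)
      then show "(\<Sum>y\<in>pverts (?Gs ! i). adj_matrix (?Gs ! i) x y * g s i y) =
          of_int (\<theta> s i) * g s i x"
        using i ms[of i] by (simp add: pverts adj_matrix_complete_graph_mult[OF x])
          (simp add: g_def \<theta>_def field_simps)
    qed (use B that in \<open>auto simp: complete_graph_def\<close>)
    then have "(\<Sum>w\<in>pverts ?N. adj_matrix ?N u w * f s w) = of_int (\<Lambda> (\<theta> s)) * f s u"
      by (simp add: f_def \<Lambda>_def if_distrib cong: if_cong)
    then have "?c * (\<Sum>w\<in>pverts ?N. adj_matrix ?N u w * f s w) =
        ?c * (of_int (\<Lambda> (\<theta> s)) * f s u)"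
      by (rule arg_cong)
    then show ?thesis
      by (simp only: sum_distrib_left mult.assoc)
  qed
  have dec: "(\<Sum>s\<in>S. f s u) = (if u = v then 1 else 0)" if "u \<in> pverts ?N" for u
  proof -
    \<comment> \<open>Summing over all choices factors over the coordinates, where the two parts add
      up to the unit vector again.\<close>
    have "(\<Sum>s\<in>S. f s u) = (\<Prod>i<?m. \<Sum>b\<in>UNIV. if b then 1 / of_nat (ms ! i)
        else of_bool (u ! i = v ! i) - 1 / of_nat (ms ! i))"
      unfolding S_def f_def g_def by (rule prod_sum_PiE[symmetric]) auto
    also have "\<dots> = (\<Prod>i<?m. of_bool (u ! i = v ! i))"
      by (simp add: UNIV_bool)
    also have "\<dots> = (if u = v then 1 else 0)"
      using that v by (auto simp: NEPS_def list_eq_iff_nth_eq)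
    finally show ?thesis .
  qed
  have "transition_matrix ?N (2 * pi / real h) v v =
      (\<Sum>s\<in>S. exp (?c * of_int (\<Lambda> (\<theta> s))) * f s v)"
    unfolding transition_matrix_def by (rule mat_exp_on_eigenvectors[OF v eig dec])
  \<comment> \<open>Where \<open>h\<close> divides \<open>ms ! i\<close>, both possible values of
    \<open>\<theta> s i\<close> are -1 modulo \<open>h\<close>, so all terms share one
    phase.\<close>
  also have "\<dots> = (\<Sum>s\<in>S. exp (?c * of_int (\<Lambda> (\<lambda>_. - 1))) * f s v)"
  proof (intro sum.cong refl arg_cong2[where f = "(*)"] exp_2pi_i_cong h)
    fix s
    show "[\<Lambda> (\<theta> s) = \<Lambda> (\<lambda>_. - 1)] (mod int h)"
      unfolding \<Lambda>_def
    proof (intro cong_sum cong_prod)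
      fix a i assume "a \<in> B" "i \<in> {..<?m}"
      then show "[(if a ! i = 0 then 1 else \<theta> s i) = (if a ! i = 0 then 1 else - 1)] (mod int h)"
        using dvd[of a i] by (simp add: \<theta>_def cong_iff_dvd_diff)
    qed
  qed
  also have "\<dots> = exp (?c * of_int (\<Lambda> (\<lambda>_. - 1)))"
    using dec[OF v] by (simp add: sum_distrib_left[symmetric])
  \<comment> \<open>\<open>\<Lambda>\<close> is integer-valued, so the exponent is purely
    imaginary.\<close>
  finally show "cmod (transition_matrix ?N (2 * pi / real h) v v) = 1"
    by simp
qed

theorem theorem1p1:
  fixes d r :: nat and ns :: "nat list" and A :: "bit list set"
  assumes "d \<ge> 1" and "r \<ge> 1"
    and "length ns = d" and "\<forall>n\<in>set ns. n \<ge> 3"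
    and "A \<noteq> {}" and "A \<subseteq> Z2_vectors (d + r) - {replicate (d + r) 0}"
    and "\<forall>a\<in>A. \<forall>i. d \<le> i \<and> i < d + r \<longrightarrow> a ! i = 0"
  shows "periodic_with_period
           (NEPS (map complete_graph ns @ replicate r (complete_graph 2)) A)
           (2 * pi / real (Gcd (set ns)))"
proof -
  have "periodic_with_period (NEPS (map complete_graph (ns @ replicate r 2)) A)
          (2 * pi / real (Gcd (set ns)))"
  proof (rule NEPS_complete_graphs_periodic)
    show "n > 0" if "n \<in> set (ns @ replicate r 2)" for n
      using that assms(4) by fastforce
    show "A \<subseteq> Z2_vectors (length (ns @ replicate r 2))"
      using assms(3,6) by auto
    \<comment> \<open>A \<open>Gcd\<close> is 0 only for subsets of \<open>{0}\<close>; here the set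
      has an element, which is at least 3.\<close>
    have "ns ! 0 \<in> set ns"
      using assms(1,3) by simp
    then show "Gcd (set ns) > 0"
      using assms(4) by (metis Gcd_0_iff gr0I not_numeral_le_zero singletonD subsetD)
    show "Gcd (set ns) dvd (ns @ replicate r 2) ! i"
      if "a \<in> A" "i < length (ns @ replicate r 2)" "a ! i \<noteq> 0" for a i
    proof -
      \<comment> \<open>The last \<open>r\<close> entries of \<open>a\<close> vanish, so a nonzero
        entry sits at a factor whose order is in \<open>ns\<close>.\<close>
      have "i < length ns"
        using that assms(3,7) by (metis length_append length_replicate not_less)
      then show ?thesis
        by (simp add: nth_append Gcd_dvd)
    qed
  qed
  then show ?thesis
    by simp
qed

end
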